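(* Let $F$ be a finite forest with no vertices of degree $2$ and no isolated vertices, and let $n_1$ be the number of vertices of degree $1$ in $F$. Then the total vertex irregularity strength of $F$ satisfies \[ tvs(F)=\left\lceil \tfrac{n_1+1}{2} \right\rceil. \]
   Context: Graphs are finite, simple and undirected. For a graph $G$, a total weighting is a map $w: V(G)\cup E(G)\to \{1,2,\dots\}$; the weighted degree of a vertex $v$ is $wt_G(v)=w(v)+\sum_{e\in E(G),\, v\in e} w(e)$. The weighting is irregular if $wt_G(u)\neq wt_G(v)$ for all distinct $u,v\in V(G)$. The total vertex irregularity strength $tvs(G)$ is the smallest integer $s$ such that there is an irregular total weighting of $G$ with values in $\{1,2,\dots,s\}$. *)

theory Defs
  imports Complex_Main
begin

definition simple_graph :: "'a set \<Rightarrow> 'a set set \<Rightarrow> bool" where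
  "simple_graph V E \<longleftrightarrow> finite V \<and> (\<forall>e\<in>E. e \<subseteq> V \<and> card e = 2)"

definition degree :: "'a set set \<Rightarrow> 'a \<Rightarrow> nat" where
  "degree E v = card {e\<in>E. v \<in> e}"

definition is_cycle :: "'a set \<Rightarrow> 'a set set \<Rightarrow> 'a list \<Rightarrow> bool" where
  "is_cycle V E cs \<longleftrightarrow> length cs \<ge> 3 \<and> distinct cs \<and> set cs \<subseteq> V \<and>
     (\<forall>i < length cs - 1. {cs ! i, cs ! Suc i} \<in> E) \<and> {last cs, hd cs} \<in> E"

definition forest :: "'a set \<Rightarrow> 'a set set \<Rightarrow> bool" where
  "forest V E \<longleftrightarrow> simple_graph V E \<and> (\<nexists>cs. is_cycle V E cs)"

definition wt :: "'a set set \<Rightarrow> ('a \<Rightarrow> nat) \<Rightarrow> ('a set \<Rightarrow> nat) \<Rightarrow> 'a \<Rightarrow> nat" where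
  "wt E wv we v = wv v + (\<Sum>e\<in>{e\<in>E. v \<in> e}. we e)"

definition irregular_total_weighting ::
  "'a set \<Rightarrow> 'a set set \<Rightarrow> nat \<Rightarrow> ('a \<Rightarrow> nat) \<Rightarrow> ('a set \<Rightarrow> nat) \<Rightarrow> bool" where
  "irregular_total_weighting V E s wv we \<longleftrightarrow>
     (\<forall>v\<in>V. wv v \<in> {1..s}) \<and> (\<forall>e\<in>E. we e \<in> {1..s}) \<and>
     inj_on (wt E wv we) V"

definition tvs :: "'a set \<Rightarrow> 'a set set \<Rightarrow> nat" where
  "tvs V E = (LEAST s. \<exists>wv we. irregular_total_weighting V E s wv we)"

end

theory Submission
  imports Defs
begin

text \<open>
  Let \<open>s = \<lceil>(n\<^sub>1 + 1) / 2\<rceil>\<close>. The \<open>n\<^sub>1\<close> leaves need distinct weighted degrees in \<open>{2..2s}\<close>, which is the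
  lower bound. For the upper bound, give weight \<open>s\<close> to all edges between inner vertices, and let the
  weighted degrees of the leaves fill \<open>{2..n\<^sub>1 + 1}\<close>, with pendant edges as heavy as possible: about
  half of them get weight \<open>s\<close>, and the others get the distinct \<^emph>\<open>small\<close> weights \<open>1, s - 1, 2, s - 2, \<dots>\<close>.
  (For components that are single edges a separate range of degrees is reserved.) Going through the leaves
  parent by parent, the two kinds of weight are used alternately. Consecutive small weights
  sum to \<open>s\<close> or \<open>s + 1\<close>, hence the edges at each inner vertex sum to at least \<open>2s\<close>, and if the vertex
  receives an odd number of small weights then this sum is congruent modulo \<open>s\<close> to one of them. So
  the latter vertices have pairwise distinct edge sums. In a forest without vertices of degree 2, all
  but at most \<open>s - 1\<close> inner vertices are of this kind, provided that the parents of exactly three leaves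
  are treated first, and then a greedy choice of the weights of the inner vertices makes their
  weighted degrees distinct.
\<close>

subsection \<open>Forests\<close>

lemma simple_graph_finite_edges:
  assumes "simple_graph V E"
  shows "finite E"
proof -
  have "E \<subseteq> Pow V" "finite V"
    using assms by (auto simp: simple_graph_def)
  then show ?thesis
    by (meson finite_Pow_iff finite_subset)
qed

lemma forest_subgraph:
  assumes "forest V E" "W \<subseteq> V" "F \<subseteq> E" "\<forall>e\<in>F. e \<subseteq> W"
  shows "forest W F"
  unfolding forest_def
proof
  show "simple_graph W F"
    using assms by (auto simp: forest_def simple_graph_def intro: finite_subset)
  show "\<nexists>cs. is_cycle W F cs"
  proof
    assume "\<exists>cs. is_cycle W F cs"
    then obtain cs where "is_cycle W F cs" by blast
    then have "is_cycle V E cs"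
      using assms(2,3) unfolding is_cycle_def by blast
    then show False
      using assms(1) by (auto simp: forest_def)
  qed
qed

text \<open>The first vertex of a longest path has no second edge: its other end would either
  prolong the path or close a cycle with an initial segment.\<close>

lemma forest_has_vertex_of_degree_le_1:
  assumes F: "forest V E" and ne: "V \<noteq> {}"
  shows "\<exists>v\<in>V. degree E v \<le> 1"
proof (rule ccontr)
  assume "\<not> ?thesis"
  then have deg: "degree E v \<ge> 2" if "v \<in> V" for v
    using that by force
  have sg: "finite V" "\<And>e. e \<in> E \<Longrightarrow> e \<subseteq> V \<and> card e = 2"
    using F by (auto simp: forest_def simple_graph_def)
  define path where "path xs \<longleftrightarrow> xs \<noteq> [] \<and> distinct xs \<and> set xs \<subseteq> V \<and>
     (\<forall>i < length xs - 1. {xs ! i, xs ! Suc i} \<in> E)" for xs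
  obtain x where "x \<in> V" using ne by blast
  then have "path [x]" by (auto simp: path_def)
  moreover have "\<forall>xs. path xs \<longrightarrow> length xs < Suc (card V)"
  proof (intro allI impI)
    fix xs assume "path xs"
    then have "card (set xs) = length xs" "set xs \<subseteq> V"
      by (auto simp: path_def distinct_card)
    then show "length xs < Suc (card V)" using card_mono[OF sg(1)] by (metis less_Suc_eq_le)
  qed
  ultimately obtain xs where xs: "path xs" and max: "\<And>ys. path ys \<Longrightarrow> length ys \<le> length xs"
    using ex_has_greatest_nat[of path "[x]" length "Suc (card V)"] by blast
  define v where "v = hd xs"
  have v: "v \<in> V" "v = xs ! 0"
    using xs by (auto simp: v_def path_def hd_conv_nth)
  \<comment> \<open>For a path with a single vertex, \<open>xs ! 1\<close> is an unspecified
    element; excluding one edge is still harmless, since \<open>v\<close> has degree at least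
    2.\<close>
  have "\<not> {e \<in> E. v \<in> e} \<subseteq> {{v, xs ! 1}}"
  proof
    assume "{e \<in> E. v \<in> e} \<subseteq> {{v, xs ! 1}}"
    then have "degree E v \<le> card {{v, xs ! 1}}"
      unfolding degree_def by (intro card_mono) auto
    then show False using deg[OF v(1)] by simp
  qed
  then obtain e where e: "e \<in> E" "v \<in> e" "e \<noteq> {v, xs ! 1}" by blast
  then obtain w where w: "e = {v, w}" "w \<noteq> v" "w \<in> V"
    using sg(2)[OF e(1)] by (auto simp: card_2_iff doubleton_eq_iff)
  have "w \<in> set xs"
  proof (rule ccontr)
    assume "w \<notin> set xs"
    have "{(w # xs) ! i, (w # xs) ! Suc i} \<in> E" if "i < length (w # xs) - 1" for i
    proof (cases i)
      case 0
      then show ?thesis using e(1) w(1) v(2) by (simp add: insert_commute)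
    next
      case (Suc j)
      then show ?thesis using xs that by (auto simp: path_def)
    qed
    then have "path (w # xs)"
      using xs w \<open>w \<notin> set xs\<close> unfolding path_def by auto
    then show False using max by fastforce
  qed
  then obtain i where i: "i < length xs" "w = xs ! i"
    by (metis in_set_conv_nth)
  have "i \<noteq> 0" "i \<noteq> 1" using i w v(2) e(3) by auto
  then have i2: "i \<ge> 2" by simp
  let ?c = "take (Suc i) xs"
  have "last ?c = w" "hd ?c = v"
    using i xs by (auto simp: take_Suc_conv_app_nth[of i xs] v_def path_def hd_append hd_conv_nth)
  moreover have "set ?c \<subseteq> V"
    using xs set_take_subset[of "Suc i" xs] unfolding path_def by blast
  ultimately have "is_cycle V E ?c"
    using xs i i2 e(1) w(1) unfolding is_cycle_def path_def by (auto simp: insert_commute)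
  then show False using F by (auto simp: forest_def)
qed

text \<open>Deleting a vertex of degree at most 1 loses at most one edge. Applied later to the
  subgraph of inner edges, where it bounds the degree sum.\<close>

lemma forest_card_edges_less:
  assumes "forest V E" "V \<noteq> {}"
  shows "card E < card V"
  using assms
proof (induction "card V" arbitrary: V E)
  case 0
  then show ?case by (simp add: forest_def simple_graph_def)
next
  case (Suc n)
  have fin: "finite V" "finite E"
    using Suc.prems simple_graph_finite_edges by (auto simp: forest_def simple_graph_def)
  obtain v where v: "v \<in> V" "degree E v \<le> 1"
    using forest_has_vertex_of_degree_le_1 Suc.prems by blast
  let ?W = "V - {v}" and ?F = "{e \<in> E. v \<notin> e}"
  have sub: "\<forall>e\<in>?F. e \<subseteq> ?W"
    using Suc.prems by (auto simp: forest_def simple_graph_def)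
  have F: "forest ?W ?F"
    by (rule forest_subgraph[OF Suc.prems(1)]) (use sub in auto)
  have cW: "card ?W = n" "card V = Suc n"
    using Suc.hyps(2) v(1) fin by auto
  have "E = ?F \<union> {e \<in> E. v \<in> e}" by blast
  then have cE: "card E \<le> card ?F + degree E v"
    unfolding degree_def by (metis card_Un_le)
  show ?case
  proof (cases "?W = {}")
    case True
    then have V: "V = {v}" using v by blast
    have "E = {}"
    proof (rule ccontr)
      assume "E \<noteq> {}"
      then obtain e where "e \<in> E" by blast
      then have "e \<subseteq> {v}" "card e = 2"
        using Suc.prems(1) V by (auto simp: forest_def simple_graph_def)
      then show False using card_mono[of "{v}" e] by simp
    qed
    then show ?thesis using V by simp
  next
    case False
    then have "card ?F < card ?W"
      using Suc.hyps(1)[of ?W ?F] F cW by simp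
    then show ?thesis using cE v(2) cW by linarith
  qed
qed

lemma sum_degree:
  assumes "simple_graph V E"
  shows "(\<Sum>v\<in>V. degree E v) = 2 * card E"
proof -
  have "card {v \<in> V. v \<in> e} = 2" if "e \<in> E" for e
  proof -
    have "{v \<in> V. v \<in> e} = e" using that assms by (auto simp: simple_graph_def)
    then show ?thesis using that assms by (simp add: simple_graph_def)
  qed
  then have "(\<Sum>v\<in>V. card {e \<in> E. v \<in> e}) = (\<Sum>e\<in>E. 2)"
    using assms simple_graph_finite_edges[OF assms]
    by (intro sum_multicount_gen) (auto simp: simple_graph_def)
  then show ?thesis by (simp add: degree_def)
qed

subsection \<open>Greedy distinct representatives\<close>

text \<open>A system of distinct representatives for the intervals
  \<open>b v < x <= b v + s\<close>. It later produces the weighted degrees of the inner vertices,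
  with \<open>b\<close> as the sum of the edge weights.\<close>

lemma distinct_representatives:
  fixes b :: "'a \<Rightarrow> nat"
  assumes "finite I" and inj: "inj_on b P" and P: "P \<subseteq> I" and Q: "card (I - P) < s"
  shows "\<exists>f. inj_on f I \<and> (\<forall>v\<in>I. b v < f v \<and> f v \<le> b v + s)"
proof -
  \<comment> \<open>Hall's condition for these intervals: \<open>P\<close> contributes at most
    \<open>hi - lo + 1\<close> elements, the rest at most \<open>s - 1\<close>.\<close>
  have window: "card {u \<in> I. lo \<le> b u \<and> b u \<le> hi} + lo \<le> s + hi" if "lo \<le> hi" for lo hi
  proof -
    let ?W = "{u \<in> P. lo \<le> b u \<and> b u \<le> hi}"
    have "card ?W = card (b ` ?W)"
      using inj by (metis (no_types, lifting) card_image inj_on_subset mem_Collect_eq subsetI)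
    also have "\<dots> \<le> card {lo..hi}" by (intro card_mono) auto
    finally have "card ?W + lo \<le> hi + 1" using that by simp
    moreover have "card {u \<in> I. lo \<le> b u \<and> b u \<le> hi} \<le> card (?W \<union> (I - P))"
      using \<open>finite I\<close> P by (intro card_mono) (auto intro: finite_subset)
    ultimately show ?thesis using Q card_Un_le[of ?W "I - P"] by linarith
  qed
  have upd: "inj_on (f(x := y)) (insert x S)" if "inj_on f S" "x \<notin> S" "\<forall>v\<in>S. f v < y"
    for f :: "'a \<Rightarrow> nat" and x y S
    using that unfolding inj_on_def by (auto simp: less_le)
  \<comment> \<open>Greedy choice in order of increasing \<open>b\<close>; \<open>w\<close> is where the current run of consecutive values starts.\<close>
  define good where "good S \<longleftrightarrow> (S \<subseteq> I \<longrightarrow> S \<noteq> {} \<longrightarrow> (\<exists>f. inj_on f S \<and> (\<forall>v\<in>S. b v < f v \<and> f v \<le> b v + s) \<and>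
     (\<exists>w\<in>S. \<forall>v\<in>S. f v \<le> b w + card {u \<in> S. b w \<le> b u})))" for S
  have "good I" using \<open>finite I\<close>
  proof (induction I rule: finite_ranking_induct[where f = b])
    case empty
    then show ?case by (simp add: good_def)
  next
    case (insert x S)
    show ?case
    proof (cases "x \<in> S")
      case True
      then show ?thesis using insert by (simp add: insert_absorb)
    next
      case x: False
      show ?thesis unfolding good_def
      proof (intro impI)
        assume sub: "insert x S \<subseteq> I"
        show "\<exists>f. inj_on f (insert x S) \<and> (\<forall>v\<in>insert x S. b v < f v \<and> f v \<le> b v + s) \<and>
          (\<exists>w\<in>insert x S. \<forall>v\<in>insert x S. f v \<le> b w + card {u \<in> insert x S. b w \<le> b u})"
        proof (cases "S = {}")
          case True
          have "{u. u = x \<and> b x \<le> b u} = {x}" by auto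
          then show ?thesis using True Q by (intro exI[of _ "\<lambda>v. b v + 1"]) auto
        next
          case False
          then obtain f w where f: "inj_on f S" "\<forall>v\<in>S. b v < f v \<and> f v \<le> b v + s"
            and w: "w \<in> S" "\<forall>v\<in>S. f v \<le> b w + card {u \<in> S. b w \<le> b u}"
            using insert.IH sub unfolding good_def by auto
          show ?thesis
          proof (cases "\<forall>v\<in>S. f v \<le> b x")
            case True
            \<comment> \<open>Nothing chosen so far exceeds \<open>b x\<close>, so \<open>x\<close>
              starts a new run.\<close>
            let ?g = "f(x := b x + 1)"
            have "card {x} \<le> card {u \<in> insert x S. b x \<le> b u}"
              using \<open>finite S\<close> by (intro card_mono) auto
            then have "1 \<le> card {u \<in> insert x S. b x \<le> b u}" by simp
            moreover have "inj_on ?g (insert x S)"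
              using True by (intro upd[OF f(1) x]) auto
            ultimately show ?thesis
              using f(2) x True Q by (intro exI[of _ ?g]) (auto intro!: bexI[of _ x] simp: le_SucI)
          next
            case F: False
            then obtain y where y: "y \<in> S" "f y > b x" by force
            \<comment> \<open>This value lies past all earlier choices, one of which already exceeds
              \<open>b x\<close>; \<open>window\<close> for \<open>b w\<close> and
              \<open>b x\<close> bounds it by \<open>b x + s\<close>.\<close>
            let ?n = "b w + card {u \<in> insert x S. b w \<le> b u}"
            let ?g = "f(x := ?n)"
            have wx: "b w \<le> b x" using insert.hyps w(1) by blast
            have "{u \<in> insert x S. b w \<le> b u} = insert x {u \<in> S. b w \<le> b u}"
              using wx by auto
            then have n: "?n = b w + card {u \<in> S. b w \<le> b u} + 1"
              using x \<open>finite S\<close> by simp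
            then have lt: "f v < ?n" if "v \<in> S" for v
              using w(2) that by fastforce
            have "b x < ?n" using y lt[OF y(1)] by linarith
            moreover have "?n \<le> b x + s"
            proof -
              have "card {u \<in> insert x S. b w \<le> b u} \<le> card {u \<in> I. b w \<le> b u \<and> b u \<le> b x}"
                using sub insert.hyps \<open>finite I\<close> by (intro card_mono) auto
              then show ?thesis using window[OF wx] by linarith
            qed
            moreover have "inj_on ?g (insert x S)"
              using lt by (intro upd[OF f(1) x]) auto
            ultimately show ?thesis
              using f(2) x lt w(1) by (intro exI[of _ ?g] conjI) (auto intro!: bexI[of _ w] less_imp_le)
          qed
        qed
      qed
    qed
  qed
  then show ?thesis unfolding good_def by (cases "I = {}") auto
qed

subsection \<open>Weights of pendant edges\<close>

definition smalls :: "nat \<Rightarrow> nat \<Rightarrow> nat" where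
  "smalls s q = (if even q then q div 2 + 1 else s - (q + 1) div 2)"

text \<open>\<open>p\<close> is the position of a leaf in the list that goes parent by parent; the
  value is the weight of its pendant edge.\<close>

definition slot :: "nat \<Rightarrow> nat \<Rightarrow> nat" where
  "slot s p = (if even p then s else smalls s (p div 2))"

text \<open>The number of odd positions, that is of small weights, in the block \<open>{d..<d + k}\<close>.\<close>
definition num_odd :: "nat \<Rightarrow> nat \<Rightarrow> nat" where
  "num_odd d k = (d + k) div 2 - d div 2"

lemma num_odd_eq: "num_odd d k = (k + d mod 2) div 2"
proof -
  have "(d + k) div 2 = d div 2 + (k + d mod 2) div 2" by presburger
  then show ?thesis by (simp add: num_odd_def)
qed

lemma smalls_bounds:
  assumes "q + 1 < s"
  shows "1 \<le> smalls s q" "smalls s q < s"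
  using assms by (auto simp: smalls_def)

text \<open>The ascending and the descending values do not meet: a common value at an even
  \<open>q\<close> and an odd \<open>q'\<close> forces \<open>q + q' = 2 * s - 3\<close>, whereas
  both are at most \<open>s - 2\<close>.\<close>

lemma inj_on_smalls: "inj_on (smalls s) {q. q + 1 < s}"
  unfolding inj_on_def smalls_def by (auto elim!: evenE oddE)

lemma sum_smalls_even:
  assumes "even m" "m + 2 * i \<le> s"
  shows "(\<Sum>q = m..<m + 2 * i. smalls s q) = i * s"
  using assms(2)
proof (induction i)
  case (Suc i)
  have "smalls s (m + 2 * i) + smalls s (m + 2 * i + 1) = s"
    using Suc.prems assms(1) by (auto simp: smalls_def elim!: evenE)
  then show ?case using Suc by simp
qed simp

lemma sum_smalls_odd:
  assumes "odd m" "m + 2 * i \<le> s"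
  shows "(\<Sum>q = m..<m + 2 * i. smalls s q) = i * (s + 1)"
  using assms(2)
proof (induction i)
  case (Suc i)
  have "smalls s (m + 2 * i) + smalls s (m + 2 * i + 1) = s + 1"
    using Suc.prems assms(1) by (auto simp: smalls_def elim!: oddE)
  then show ?case using Suc by simp
qed simp

text \<open>Pair consecutive small weights so that each pair starts at an even index and sums to
  exactly \<open>s\<close>. The one left over is the last if \<open>m\<close> is even and the first
  if \<open>m\<close> is odd.\<close>

lemma sum_smalls_odd_length:
  assumes "m + (2 * i + 1) \<le> s"
  shows "\<exists>q\<in>{m..<m + (2 * i + 1)}. (\<Sum>q = m..<m + (2 * i + 1). smalls s q) = i * s + smalls s q"
proof (cases "even m")
  case True
  then show ?thesis using sum_smalls_even[of m i s] assms
    by (intro bexI[of _ "m + 2 * i"]) auto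
next
  case False
  have "(\<Sum>q = m..<m + (2 * i + 1). smalls s q) = smalls s m + (\<Sum>q = Suc m..<Suc m + 2 * i. smalls s q)"
    by (subst sum.atLeast_Suc_lessThan) auto
  then show ?thesis using False sum_smalls_even[of "Suc m" i s] assms
    by (intro bexI[of _ m]) auto
qed

lemma sum_smalls_ge:
  assumes "m + a \<le> s"
  shows "(a div 2) * s \<le> (\<Sum>q = m..<m + a. smalls s q)"
proof (cases "even a")
  case True
  then obtain i where "a = 2 * i" by blast
  then show ?thesis using sum_smalls_even[of m i s] sum_smalls_odd[of m i s] assms
    by (cases "even m") auto
next
  case False
  then obtain i where "a = 2 * i + 1" by (blast elim: oddE)
  then show ?thesis using sum_smalls_odd_length[of m i s] assms by auto
qed

text \<open>Compared with \<open>k\<close> edges of weight \<open>s\<close>, each odd position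
  exchanges one \<open>s\<close> for a small weight. Terms are moved across to avoid
  subtraction.\<close>

lemma sum_slot:
  "(\<Sum>p = d..<d + k. slot s p) + s * ((d + k) div 2) =
     s * k + s * (d div 2) + (\<Sum>q = d div 2..<(d + k) div 2. smalls s q)"
proof (induction k)
  case (Suc k)
  show ?case
  proof (cases "even (d + k)")
    case True
    then have "(d + Suc k) div 2 = (d + k) div 2" "slot s (d + k) = s"
      by (auto simp: slot_def)
    then show ?thesis using Suc by simp
  next
    case False
    then have "(d + Suc k) div 2 = Suc ((d + k) div 2)" "slot s (d + k) = smalls s ((d + k) div 2)"
      by (auto simp: slot_def)
    moreover have "d div 2 \<le> (d + k) div 2" by (simp add: div_le_mono)
    ultimately show ?thesis using Suc by simp
  qed
qed simp

lemma sum_slot_num_odd: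
  "(\<Sum>p = d..<d + k. slot s p) + s * num_odd d k =
     s * k + (\<Sum>q = d div 2..<d div 2 + num_odd d k. smalls s q)"
proof -
  have "(d + k) div 2 = d div 2 + num_odd d k"
    by (simp add: num_odd_def div_le_mono)
  then show ?thesis
    using sum_slot[of s d k] by (simp add: algebra_simps)
qed

text \<open>Each pair of small weights makes up for one \<open>s\<close>, so a block with
  \<open>a\<close> of them falls short of \<open>s * k\<close> by at most \<open>s\<close> times
  \<open>a / 2\<close> rounded up.\<close>

lemma sum_slot_ge:
  assumes "d + k \<le> 2 * s"
  shows "s * k \<le> (\<Sum>p = d..<d + k. slot s p) + s * ((num_odd d k + 1) div 2)"
proof -
  define a where "a = num_odd d k"
  have "d div 2 + a \<le> s" using assms by (simp add: a_def num_odd_def div_le_mono)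
  from sum_smalls_ge[OF this]
  have "s * k + (a div 2) * s \<le> (\<Sum>p = d..<d + k. slot s p) + s * a"
    using sum_slot_num_odd[of s d k] by (simp add: a_def)
  moreover have "s * a = (a div 2) * s + s * ((a + 1) div 2)"
    by (cases "even a") (auto elim!: evenE oddE simp: algebra_simps)
  ultimately show ?thesis unfolding a_def by linarith
qed

text \<open>An odd number of small weights leaves one of them as the residue. As small weights are
  distinct, this residue will identify the block. The strict bound keeps the small weights in the
  block below \<open>s\<close>.\<close>

lemma sum_slot_mod:
  assumes "d + k < 2 * s" "odd (num_odd d k)"
  shows "\<exists>p\<in>{d..<d + k}. odd p \<and> (\<Sum>p = d..<d + k. slot s p) mod s = slot s p"
proof -
  obtain i where i: "num_odd d k = 2 * i + 1" using assms(2) by (blast elim: oddE)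
  have le: "d div 2 + (2 * i + 1) \<le> s" and eq: "d div 2 + (2 * i + 1) = (d + k) div 2"
    using assms i by (auto simp: num_odd_def div_le_mono)
  obtain q where q: "q \<in> {d div 2..<d div 2 + (2 * i + 1)}"
    and sm: "(\<Sum>q = d div 2..<d div 2 + (2 * i + 1). smalls s q) = i * s + smalls s q"
    using sum_smalls_odd_length[OF le] by blast
  have "(\<Sum>p = d..<d + k. slot s p) + s * (2 * i + 1) = s * (k + i) + smalls s q"
    using sum_slot_num_odd[of s d k] sm i by (simp add: algebra_simps)
  then have "(\<Sum>p = d..<d + k. slot s p) mod s = smalls s q mod s"
    by (metis mod_mult_self2 mod_mult_self4)
  moreover have "smalls s q < s"
    using q eq assms(1) by (intro smalls_bounds) auto
  moreover have "2 * q + 1 \<in> {d..<d + k}"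
    using q eq by auto
  ultimately show ?thesis
    by (intro bexI[of _ "2 * q + 1"]) (auto simp: slot_def)
qed

section \<open>Placement of the blocks of leaves\<close>

lemma append_block:
  assumes "finite A" "x \<notin> A"
    and "\<forall>v\<in>A. off v + k v \<le> sum k A"
    and "\<forall>u\<in>A. \<forall>v\<in>A. u \<noteq> v \<longrightarrow> {off u..<off u + k u} \<inter> {off v..<off v + k v} = {}"
  defines "off' \<equiv> off(x := sum k A)"
  shows "\<forall>v\<in>insert x A. off' v + k v \<le> sum k (insert x A)"
    and "\<forall>u\<in>insert x A. \<forall>v\<in>insert x A. u \<noteq> v \<longrightarrow> {off' u..<off' u + k u} \<inter> {off' v..<off' v + k v} = {}"
    and "card {v \<in> insert x A. odd (num_odd (off' v) (k v))} =
      card {v \<in> A. odd (num_odd (off v) (k v))} + (num_odd (sum k A) (k x)) mod 2"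
proof -
  show "\<forall>v\<in>insert x A. off' v + k v \<le> sum k (insert x A)"
    using assms by (auto intro: trans_le_add2)
  show "\<forall>u\<in>insert x A. \<forall>v\<in>insert x A. u \<noteq> v \<longrightarrow> {off' u..<off' u + k u} \<inter> {off' v..<off' v + k v} = {}"
  proof (intro ballI impI)
    fix u v assume "u \<in> insert x A" "v \<in> insert x A" "u \<noteq> v"
    then consider "u \<in> A" "v \<in> A" | "u = x" "v \<in> A" | "u \<in> A" "v = x" by blast
    then show "{off' u..<off' u + k u} \<inter> {off' v..<off' v + k v} = {}"
    proof cases
      case 1
      then show ?thesis using assms(2,4) \<open>u \<noteq> v\<close> by (auto simp: off'_def)
    next
      case 2
      then have "off v + k v \<le> sum k A" using assms(3) by blast
      then show ?thesis using 2 assms(2) by (auto simp: off'_def)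
    next
      case 3
      then have "off u + k u \<le> sum k A" using assms(3) by blast
      then show ?thesis using 3 assms(2) by (auto simp: off'_def)
    qed
  qed
  have "{v \<in> insert x A. odd (num_odd (off' v) (k v))} =
    (if odd (num_odd (sum k A) (k x)) then {x} else {}) \<union> {v \<in> A. odd (num_odd (off v) (k v))}"
    using assms(2) by (auto simp: off'_def)
  then show "card {v \<in> insert x A. odd (num_odd (off' v) (k v))} =
      card {v \<in> A. odd (num_odd (off v) (k v))} + (num_odd (sum k A) (k x)) mod 2"
    using assms(1,2) by (auto simp: even_iff_mod_2_eq_zero odd_iff_mod_2_eq_one)
qed

text \<open>
  Blocks of length 1 contain a small weight iff they start at an odd position, whereas for blocks of
  length 3 the number of small weights is odd iff they start at an even position. Both kinds toggle
  the parity, so half of them are counted if the blocks of length 3 come first, starting at 0.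
\<close>
lemma ex_blocks:
  fixes k :: "'a \<Rightarrow> nat"
  assumes "finite A" "\<forall>v\<in>A. 1 \<le> k v"
  shows "\<exists>off. (\<forall>v\<in>A. off v + k v \<le> sum k A) \<and>
    (\<forall>u\<in>A. \<forall>v\<in>A. u \<noteq> v \<longrightarrow> {off u..<off u + k u} \<inter> {off v..<off v + k v} = {}) \<and>
    (\<Sum>v\<in>A. if k v = 1 then 2 else 4) \<le>
      2 * card {v \<in> A. odd (num_odd (off v) (k v))} + sum k A + sum k A mod 2"
proof -
  define blocks where "blocks A off \<longleftrightarrow> (\<forall>v\<in>A. off v + k v \<le> sum k A) \<and>
    (\<forall>u\<in>A. \<forall>v\<in>A. u \<noteq> v \<longrightarrow> {off u..<off u + k u} \<inter> {off v..<off v + k v} = {})" for A off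
  define cnt where "cnt A off = card {v \<in> A. odd (num_odd (off v) (k v))}" for A off
  define W where "W A = (\<Sum>v\<in>A. if k v = 1 then 2 else 4 :: nat)" for A
  have append: "blocks (insert x B) (off(x := sum k B))"
    "cnt (insert x B) (off(x := sum k B)) = cnt B off + num_odd (sum k B) (k x) mod 2"
    if "finite B" "x \<notin> B" "blocks B off" for x B off
    using append_block[of B x off k] that unfolding blocks_def cnt_def by auto
  \<comment> \<open>The parity of the total length acts as a potential. It stands on the left while
    blocks of length 3 are added and on the right in \<open>rest\<close>, because lengths 3 and 1
    need opposite signs in the estimate per block; the first form implies the second.\<close>
  have three: "\<exists>off. blocks B off \<and> W B + sum k B mod 2 \<le> 2 * cnt B off + sum k B"
    if "finite B" "\<forall>v\<in>B. k v = 3" for B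
    using that
  proof (induction B rule: finite_induct)
    case empty
    then show ?case by (auto simp: blocks_def W_def)
  next
    case (insert x B)
    then obtain off where off: "blocks B off" "W B + sum k B mod 2 \<le> 2 * cnt B off + sum k B"
      by auto
    have W: "W (insert x B) = 4 + W B" and kx: "k x = 3" using insert by (auto simp: W_def)
    have S: "sum k (insert x B) = sum k B + 3" using insert by simp
    have key: "4 + (t + 3) mod 2 \<le> 2 * (num_odd t 3 mod 2) + 3 + t mod 2" for t
      unfolding num_odd_eq by (cases "even t") (simp_all add: mod2_eq_if)
    have "W (insert x B) + sum k (insert x B) mod 2 \<le> 2 * cnt (insert x B) (off(x := sum k B)) + sum k (insert x B)"
      using append(2)[OF insert.hyps off(1)] off(2) key[of "sum k B"] unfolding W S kx by linarith
    then show ?case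
      using append(1)[OF insert.hyps off(1)] by blast
  qed
  define C where "C = {v \<in> A. k v = 3}"
  have C: "finite C" "\<forall>v\<in>C. k v = 3" using assms(1) by (auto simp: C_def)
  obtain off where off: "blocks C off"
    "W C + sum k C mod 2 \<le> 2 * cnt C off + sum k C"
    using three[OF C] by blast
  have rest: "\<exists>off. blocks (C \<union> B) off \<and>
      W (C \<union> B) \<le> 2 * cnt (C \<union> B) off
        + sum k (C \<union> B) + sum k (C \<union> B) mod 2"
    if "finite B" "\<forall>v\<in>B. 1 \<le> k v \<and> k v \<noteq> 3" for B
    using that
  proof (induction B rule: finite_induct)
    case empty
    then show ?case using off by (intro exI[of _ off]) auto
  next
    case (insert x B)
    let ?B = "C \<union> B"
    from insert obtain off where off: "blocks ?B off" "W ?B \<le> 2 * cnt ?B off + sum k ?B + sum k ?B mod 2"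
      by auto
    have "x \<notin> C" using insert.prems C by auto
    then have x: "x \<notin> ?B" "finite ?B" "1 \<le> k x" "k x \<noteq> 3" using insert C by auto
    have S: "sum k (insert x ?B) = sum k ?B + k x" using x by simp
    have W: "W (insert x ?B) = (if k x = 1 then 2 else 4) + W ?B"
      using x unfolding W_def by simp
    have "(if j = 1 then 2 else 4) + t mod 2 \<le> 2 * (num_odd t j mod 2) + j + (t + j) mod 2"
      if "1 \<le> j" "j \<noteq> 3" for t j :: nat
    proof -
      consider "j = 1" | "j = 2" | "j = 4" | "j \<ge> 5" using \<open>1 \<le> j\<close> \<open>j \<noteq> 3\<close> by linarith
      then show ?thesis
      proof cases
        case 4
        then have "4 + t mod 2 \<le> j" by (simp add: mod2_eq_if)
        then show ?thesis using 4 by simp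
      qed (cases "even t"; simp add: num_odd_eq mod2_eq_if)+
    qed
    from this[OF x(3,4), of "sum k ?B"]
    have "W (insert x ?B) \<le> 2 * cnt (insert x ?B) (off(x := sum k ?B)) + sum k (insert x ?B) + sum k (insert x ?B) mod 2"
      using append(2)[OF x(2,1) off(1)] off(2) unfolding W S by linarith
    moreover have "insert x ?B = C \<union> insert x B" by blast
    ultimately show ?case
      using append(1)[OF x(2,1) off(1)] by metis
  qed
  define D where "D = {v \<in> A. k v \<noteq> 3}"
  have "finite D" "\<forall>v\<in>D. 1 \<le> k v \<and> k v \<noteq> 3" "C \<union> D = A"
    using assms by (auto simp: C_def D_def)
  then show ?thesis
    using rest[of D] unfolding blocks_def cnt_def W_def by simp
qed

section \<open>Weighted degrees of leaves with an inner parent\<close>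

definition leaf_weight :: "nat \<Rightarrow> nat \<Rightarrow> nat" where
  "leaf_weight c p = (if even p then c + 1 + p div 2 else 1)"

lemma slot_bounds:
  assumes "p < n" "n div 2 + 1 \<le> s"
  shows "1 \<le> slot s p" "slot s p \<le> s"
proof -
  have "p div 2 + 1 < s" if "odd p"
    using assms that by (elim oddE) auto
  then have "1 \<le> slot s p \<and> slot s p \<le> s"
    using smalls_bounds[of "p div 2" s] assms by (auto simp: slot_def)
  then show "1 \<le> slot s p" "slot s p \<le> s" by auto
qed

lemma slot_eq_odd:
  assumes "p < n" "q < n" "n div 2 + 1 \<le> s" "odd p" "odd q" "slot s p = slot s q"
  shows "p = q"
proof -
  have "p div 2 + 1 < s" "q div 2 + 1 < s"
    using assms by (auto elim!: oddE)
  then have "p div 2 = q div 2"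
    using inj_on_smalls[of s] assms(4-6) by (auto simp: slot_def inj_on_def)
  then show ?thesis using assms(4,5) by (auto elim!: oddE)
qed

context
  fixes n c s h :: nat
  assumes s: "s = n div 2 + c + 1" and h: "h = (n div 2 + 1) div 2"
begin

text \<open>Starting at \<open>s + c + 1\<close> leaves the \<open>c\<close> values from
  \<open>s + 1\<close> to \<open>s + c\<close> free for the single-edge components, which will be
  \<open>c\<close> in number.\<close>

lemma slot_leaf_weight_even:
  assumes "p < n" "even p"
  shows "s + c + 1 \<le> slot s p + leaf_weight c p" "slot s p + leaf_weight c p \<le> 2 * s"
  using assms s by (auto simp: slot_def leaf_weight_def elim!: evenE)

text \<open>\<open>h\<close> counts the even \<open>q < n div 2\<close>: the ascending small weights
  give the degrees up to \<open>h + 1\<close>, the descending ones those from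
  \<open>h + c + 2\<close> to \<open>s\<close>. Between them lies a second gap of \<open>c\<close>
  values.\<close>

lemma slot_leaf_weight_odd:
  assumes "p < n" "odd p"
  shows "slot s p + leaf_weight c p \<le> s"
    "slot s p + leaf_weight c p \<le> h + 1 \<or> h + c + 2 \<le> slot s p + leaf_weight c p"
proof -
  obtain q where q: "p = 2 * q + 1" using assms(2) by (rule oddE)
  then have qn: "q < n div 2" using assms(1) by auto
  have eq: "slot s p + leaf_weight c p = smalls s q + 1"
    using q by (simp add: slot_def leaf_weight_def)
  show "slot s p + leaf_weight c p \<le> s"
    using smalls_bounds[of q s] qn s unfolding eq by simp
  show "slot s p + leaf_weight c p \<le> h + 1 \<or> h + c + 2 \<le> slot s p + leaf_weight c p"
    unfolding eq using qn s h by (cases "even q") (auto simp: smalls_def elim!: evenE oddE)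
qed

lemma inj_on_slot_leaf_weight: "inj_on (\<lambda>p. slot s p + leaf_weight c p) {..<n}"
proof (rule inj_onI)
  fix p q assume pq: "p \<in> {..<n}" "q \<in> {..<n}"
    and eq: "slot s p + leaf_weight c p = slot s q + leaf_weight c q"
  then have "even p \<longleftrightarrow> even q"
    using slot_leaf_weight_even(1)[of p] slot_leaf_weight_even(1)[of q]
      slot_leaf_weight_odd(1)[of p] slot_leaf_weight_odd(1)[of q] by force
  then show "p = q"
  proof (cases "even p")
    case True
    then show ?thesis using eq \<open>even p \<longleftrightarrow> even q\<close>
      by (auto simp: slot_def leaf_weight_def elim!: evenE)
  next
    case False
    then show ?thesis using eq \<open>even p \<longleftrightarrow> even q\<close> pq s slot_eq_odd[of p n q s]
      by (auto simp: leaf_weight_def)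
  qed
qed

end

subsection \<open>Leaves and inner vertices\<close>

locale forest_without_degree_2 =
  fixes V :: "'a set" and E :: "'a set set"
  assumes forest: "forest V E"
    and deg_neq_2: "\<And>v. v \<in> V \<Longrightarrow> degree E v \<noteq> 2"
    and deg_neq_0: "\<And>v. v \<in> V \<Longrightarrow> degree E v \<noteq> 0"
begin

definition leaves :: "'a set" where
  "leaves = {v \<in> V. degree E v = 1}"

definition inner :: "'a set" where
  "inner = V - leaves"

definition leaf_nbs :: "'a \<Rightarrow> 'a set" where
  "leaf_nbs v = {u \<in> leaves. {u, v} \<in> E}"

definition inner_edges :: "'a set set" where
  "inner_edges = {e \<in> E. e \<subseteq> inner}"

definition K2_edges :: "'a set set" where
  "K2_edges = {e \<in> E. e \<subseteq> leaves}"

lemma simple_graph: "simple_graph V E"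
  using forest by (simp add: forest_def)

lemma finite_V: "finite V"
  using simple_graph by (simp add: simple_graph_def)

lemma finite_E: "finite E"
  using simple_graph by (rule simple_graph_finite_edges)

lemma edge: "e \<in> E \<Longrightarrow> e \<subseteq> V \<and> card e = 2"
  using simple_graph by (simp add: simple_graph_def)

lemma edge_nonempty: "e \<in> E \<Longrightarrow> e \<noteq> {}"
  using edge[of e] by auto

lemma finite_leaves: "finite leaves"
  using finite_V by (simp add: leaves_def)

lemma finite_inner: "finite inner"
  using finite_V by (simp add: inner_def)

lemma finite_leaf_nbs: "finite (leaf_nbs v)"
  using finite_leaves by (simp add: leaf_nbs_def)

lemma finite_K2_edges: "finite K2_edges" and finite_inner_edges: "finite inner_edges"
  using finite_E by (auto simp: K2_edges_def inner_edges_def)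

lemma leaf_edges:
  assumes "u \<in> leaves" "e \<in> E" "u \<in> e"
  shows "{f \<in> E. u \<in> f} = {e}"
proof -
  have "card {f \<in> E. u \<in> f} = 1" using assms(1) by (simp add: leaves_def degree_def)
  then obtain g where g: "{f \<in> E. u \<in> f} = {g}" by (rule card_1_singletonE)
  have "e \<in> {f \<in> E. u \<in> f}" using assms by simp
  then show ?thesis unfolding g by simp
qed

lemma leaf_edge_unique:
  assumes "u \<in> leaves" "e \<in> E" "u \<in> e" "f \<in> E" "u \<in> f"
  shows "e = f"
proof -
  have "f \<in> {f \<in> E. u \<in> f}" using assms by simp
  then show ?thesis unfolding leaf_edges[OF assms(1-3)] by simp
qed

lemma ex_leaf_edge:
  assumes "u \<in> leaves"
  shows "\<exists>e\<in>E. u \<in> e"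
proof -
  have "card {e \<in> E. u \<in> e} \<noteq> 0" using assms by (simp add: leaves_def degree_def)
  then have "{e \<in> E. u \<in> e} \<noteq> {}" by force
  then show ?thesis by blast
qed

lemma edge_at:
  assumes "e \<in> E" "v \<in> e"
  obtains w where "e = {w, v}" "w \<noteq> v" "w \<in> V" "v \<in> V"
proof -
  obtain a b where "e = {a, b}" "a \<noteq> b" "a \<in> V" "b \<in> V"
    using edge[OF assms(1)] unfolding card_2_iff by blast
  moreover have "v = a \<or> v = b" using calculation assms(2) by blast
  ultimately show thesis using that[of a] that[of b] by (metis insert_commute)
qed

lemma edges_at_inner:
  assumes "v \<in> inner"
  shows "{e \<in> E. v \<in> e} = {e \<in> inner_edges. v \<in> e} \<union> (\<lambda>u. {u, v}) ` leaf_nbs v" (is "?L = ?R")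
proof
  show "?L \<subseteq> ?R"
  proof
    fix e assume "e \<in> ?L"
    then have e: "e \<in> E" "v \<in> e" by auto
    then obtain w where w: "e = {w, v}" "w \<noteq> v" "w \<in> V" by (rule edge_at)
    then show "e \<in> ?R"
      using e assms by (cases "w \<in> leaves") (auto simp: leaf_nbs_def inner_edges_def inner_def)
  qed
qed (auto simp: inner_edges_def leaf_nbs_def)

lemma edges_at_inner_disjoint:
  "{e \<in> inner_edges. v \<in> e} \<inter> (\<lambda>u. {u, v}) ` leaf_nbs v = {}"
  by (auto simp: inner_edges_def leaf_nbs_def inner_def)

lemma inj_on_leaf_edge: "inj_on (\<lambda>u. {u, v}) (leaf_nbs v)"
  by (auto simp: inj_on_def doubleton_eq_iff)

lemma degree_inner:
  assumes "v \<in> inner"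
  shows "degree E v = degree inner_edges v + card (leaf_nbs v)" "3 \<le> degree E v"
proof -
  show "degree E v = degree inner_edges v + card (leaf_nbs v)"
    unfolding degree_def edges_at_inner[OF assms]
    using card_Un_disjoint[OF _ _ edges_at_inner_disjoint] finite_inner_edges finite_leaf_nbs
      card_image[OF inj_on_leaf_edge] by simp
  show "3 \<le> degree E v"
    using assms deg_neq_0[of v] deg_neq_2[of v] by (auto simp: inner_def leaves_def)
qed

lemma leaf_nbs_disjoint:
  assumes "u \<in> leaf_nbs v" "u \<in> leaf_nbs w"
  shows "v = w"
proof -
  have "{u, v} = {u, w}"
    using leaf_edge_unique[of u "{u, v}" "{u, w}"] assms by (simp add: leaf_nbs_def)
  then show ?thesis by (auto simp: doubleton_eq_iff)
qed

lemma leaf_nbs_K2_disjoint: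
  assumes "u \<in> leaf_nbs v" "v \<in> inner" "e \<in> K2_edges"
  shows "u \<notin> e"
proof
  assume "u \<in> e"
  then have "{u, v} = e"
    using leaf_edge_unique[of u "{u, v}" e] assms by (simp add: leaf_nbs_def K2_edges_def)
  then show False using assms(2,3) by (auto simp: K2_edges_def inner_def)
qed

lemma leaves_eq: "leaves = \<Union> K2_edges \<union> (\<Union>v\<in>inner. leaf_nbs v)"
proof
  show "leaves \<subseteq> \<Union> K2_edges \<union> (\<Union>v\<in>inner. leaf_nbs v)"
  proof
    fix u assume u: "u \<in> leaves"
    then obtain e where e: "e \<in> E" "u \<in> e" using ex_leaf_edge by blast
    then obtain w where w: "e = {w, u}" "w \<in> V" by (rule edge_at)
    show "u \<in> \<Union> K2_edges \<union> (\<Union>v\<in>inner. leaf_nbs v)"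
    proof (cases "w \<in> leaves")
      case True
      then have "e \<in> K2_edges" using e w u by (auto simp: K2_edges_def)
      then show ?thesis using e by blast
    next
      case False
      then have "w \<in> inner" "u \<in> leaf_nbs w"
        using e w u by (auto simp: inner_def leaf_nbs_def insert_commute)
      then show ?thesis by blast
    qed
  qed
qed (auto simp: K2_edges_def leaf_nbs_def)

section \<open>Counting leaves and inner vertices\<close>

lemma card_leaves: "card leaves = 2 * card K2_edges + (\<Sum>v\<in>inner. card (leaf_nbs v))"
proof -
  have "card (\<Union> K2_edges) = (\<Sum>e\<in>K2_edges. card e)"
  proof (rule card_Union_disjoint)
    show "pairwise disjnt K2_edges"
      unfolding pairwise_def disjnt_def
    proof (intro ballI impI)
      fix e f assume "e \<in> K2_edges" "f \<in> K2_edges" "e \<noteq> f"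
      then show "e \<inter> f = {}" using leaf_edge_unique[of _ e f] by (auto simp: K2_edges_def)
    qed
    show "finite e" if "e \<in> K2_edges" for e
      using that finite_leaves by (auto simp: K2_edges_def intro: finite_subset)
  qed
  also have "\<dots> = 2 * card K2_edges"
    using edge by (simp add: K2_edges_def)
  finally have "card (\<Union> K2_edges) = 2 * card K2_edges" .
  moreover have "card (\<Union>v\<in>inner. leaf_nbs v) = (\<Sum>v\<in>inner. card (leaf_nbs v))"
    using finite_inner finite_leaf_nbs leaf_nbs_disjoint by (intro card_UN_disjoint) blast+
  moreover have "\<Union> K2_edges \<inter> (\<Union>v\<in>inner. leaf_nbs v) = {}"
    using leaf_nbs_K2_disjoint by blast
  moreover have "finite (\<Union> K2_edges)" "finite (\<Union>v\<in>inner. leaf_nbs v)"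
    using finite_leaves leaves_eq by (metis finite_Un)+
  ultimately show ?thesis
    by (metis card_Un_disjoint leaves_eq)
qed

text \<open>A vertex with \<open>j\<close> inner edges and \<open>k\<close> leaves has
  \<open>j + k >= 3\<close>, so \<open>k = 0\<close> forces \<open>j >= 3\<close>, and
  \<open>j = 1\<close> forces \<open>k >= 2\<close>. The inner edges form a forest, so
  \<open>j\<close> averages less than 2 over \<open>J\<close>, and the vertices of the second kind
  prevail.\<close>

lemma card_no_leaf_nbs_less:
  assumes "inner \<noteq> {}"
  shows "card {v \<in> inner. card (leaf_nbs v) = 0} < card {v \<in> inner. 2 \<le> card (leaf_nbs v)}"
proof -
  define k where "k v = card (leaf_nbs v)" for v
  define j where "j v = degree inner_edges v" for v
  define J where "J = {v \<in> inner. 1 \<le> j v}"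
  have jk: "3 \<le> j v + k v" if "v \<in> inner" for v
    using degree_inner[OF that] by (simp add: j_def k_def)
  have fJ: "finite J" using finite_inner by (simp add: J_def)
  show ?thesis
  proof (cases "J = {}")
    case True
    then have "3 \<le> k v" if "v \<in> inner" for v
      using that jk[OF that] by (auto simp: J_def)
    then have "{v \<in> inner. k v = 0} = {}" "{v \<in> inner. 2 \<le> k v} = inner"
      by force+
    then show ?thesis
      using assms finite_inner unfolding k_def by (metis card.empty card_gt_0_iff)
  next
    case False
    have sub: "e \<subseteq> J" if "e \<in> inner_edges" for e
    proof
      fix v assume "v \<in> e"
      then have "v \<in> inner" using that by (auto simp: inner_edges_def)
      moreover have "{e \<in> inner_edges. v \<in> e} \<noteq> {}" using that \<open>v \<in> e\<close> by blast
      ultimately show "v \<in> J"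
        using finite_inner_edges by (simp add: J_def j_def degree_def Suc_le_eq card_gt_0_iff)
    qed
    have F: "forest J inner_edges"
      by (rule forest_subgraph[OF forest]) (use sub in \<open>auto simp: J_def inner_def inner_edges_def\<close>)
    have "card inner_edges < card J"
      by (rule forest_card_edges_less[OF F False])
    then have lt: "sum j J < 2 * card J"
      using sum_degree[of J inner_edges] F by (simp add: forest_def j_def)
    let ?A = "{v \<in> J. k v = 0}" and ?B = "{v \<in> J. 2 \<le> k v}"
    have A: "card ?A = (\<Sum>v\<in>J. if k v = 0 then 1 else 0)" and B: "card ?B = (\<Sum>v\<in>J. if 2 \<le> k v then 1 else 0)"
      using fJ by (simp_all add: sum.If_cases Int_def)
    have "card ?A + 2 * card J = (\<Sum>v\<in>J. (if k v = 0 then 1 else 0) + 2)"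
      unfolding A sum.distrib by simp
    also have "\<dots> \<le> (\<Sum>v\<in>J. j v + (if 2 \<le> k v then 1 else 0))"
    proof (rule sum_mono)
      fix v assume "v \<in> J"
      then have "3 \<le> j v + k v" "1 \<le> j v" using jk by (auto simp: J_def)
      then show "(if k v = 0 then 1 else 0) + 2 \<le> j v + (if 2 \<le> k v then 1 else 0)" by auto
    qed
    also have "\<dots> = sum j J + card ?B"
      unfolding B sum.distrib by simp
    finally have "card ?A < card ?B" using lt by linarith
    moreover have "{v \<in> inner. k v = 0} = ?A"
      using jk by (force simp: J_def)
    moreover have "card ?B \<le> card {v \<in> inner. 2 \<le> k v}"
      using finite_inner by (intro card_mono) (auto simp: J_def)
    ultimately show ?thesis unfolding k_def by simp
  qed
qed

section \<open>Upper bound: construction of the weighting\<close>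

lemma ex_irregular_total_weighting:
  "\<exists>wv we. irregular_total_weighting V E (card leaves div 2 + 1) wv we"
proof -
  define k where "k v = card (leaf_nbs v)" for v
  define L where "L = {v \<in> inner. 1 \<le> k v}"
  \<comment> \<open>Only leaves with an inner parent count here; all in all there are
    \<open>n + 2 * c\<close> leaves.\<close>
  define n where "n = sum k L"
  define c where "c = card K2_edges"
  define s where "s = n div 2 + c + 1"
  define h where "h = (n div 2 + 1) div 2"
  have fL: "finite L" and L1: "\<forall>v\<in>L. 1 \<le> k v" using finite_inner by (auto simp: L_def)
  have "n = sum k inner"
    unfolding n_def L_def by (rule sum.mono_neutral_left) (use finite_inner in auto)
  then have s_eq: "s = card leaves div 2 + 1"
    using card_leaves by (simp add: s_def c_def k_def)
  obtain off where off: "\<forall>v\<in>L. off v + k v \<le> n"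
    and disj: "\<forall>u\<in>L. \<forall>v\<in>L. u \<noteq> v \<longrightarrow> {off u..<off u + k u} \<inter> {off v..<off v + k v} = {}"
    and cnt: "(\<Sum>v\<in>L. if k v = 1 then 2 else 4) \<le>
      2 * card {v \<in> L. odd (num_odd (off v) (k v))} + n + n mod 2"
    using ex_blocks[OF fL L1] unfolding n_def by blast
  have "\<forall>v\<in>L. \<exists>g. bij_betw g (leaf_nbs v) {off v..<off v + k v}"
    using finite_leaf_nbs by (auto simp: k_def intro: finite_same_card_bij)
  then obtain g where g: "\<And>v. v \<in> L \<Longrightarrow> bij_betw (g v) (leaf_nbs v) {off v..<off v + k v}"
    by metis
  \<comment> \<open>The parent is unique by \<open>leaf_nbs_disjoint\<close>, so the bijections
    \<open>g v\<close> glue to one numbering in which the leaves of \<open>v\<close> fill its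
    block.\<close>
  define pos where "pos u = g (THE v. u \<in> leaf_nbs v) u" for u
  have pos_bij: "bij_betw pos (leaf_nbs v) {off v..<off v + k v}" if "v \<in> L" for v
  proof -
    have "pos u = g v u" if "u \<in> leaf_nbs v" for u
    proof -
      have "(THE v. u \<in> leaf_nbs v) = v"
        using that leaf_nbs_disjoint by blast
      then show ?thesis by (simp add: pos_def)
    qed
    then show ?thesis using g[OF that] by (metis (no_types, lifting) bij_betw_cong)
  qed
  have in_L: "v \<in> L" if "v \<in> inner" "u \<in> leaf_nbs v" for u v
    using that finite_leaf_nbs[of v] by (auto simp: L_def k_def Suc_le_eq card_gt_0_iff)
  have pos_in: "pos u \<in> {off v..<off v + k v}" if "v \<in> inner" "u \<in> leaf_nbs v" for u v
    using pos_bij[OF in_L[OF that]] that(2) by (auto simp: bij_betw_def)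
  have pos_lt: "pos u < n" if "v \<in> inner" "u \<in> leaf_nbs v" for u v
    using pos_in[OF that] off in_L[OF that] by fastforce
  have pos_eq: "u = u'" if "v \<in> inner" "u \<in> leaf_nbs v" "v' \<in> inner" "u' \<in> leaf_nbs v'" "pos u = pos u'"
    for u u' v v'
  proof -
    have "v = v'"
      using pos_in[OF that(1,2)] pos_in[OF that(3,4)] disj in_L[OF that(1,2)] in_L[OF that(3,4)] that(5)
      by (metis IntI empty_iff)
    then show ?thesis
      using pos_bij[OF in_L[OF that(1,2)]] that by (auto simp: bij_betw_def inj_on_def)
  qed
  obtain idx where idx: "bij_betw idx K2_edges {1..c}"
    using finite_same_card_bij[OF finite_K2_edges finite_atLeastAtMost[of 1 c]] unfolding c_def
    by (metis card_atLeastAtMost diff_Suc_1)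
  have idx_in: "1 \<le> idx e \<and> idx e \<le> c" if "e \<in> K2_edges" for e
    using idx that by (auto simp: bij_betw_def)
  define we where "we e = (if e \<in> inner_edges then s else if e \<in> K2_edges then idx e
    else slot s (pos (THE u. u \<in> e \<inter> leaves)))" for e
  have we_pendant: "we {u, v} = slot s (pos u)" if "v \<in> inner" "u \<in> leaf_nbs v" for u v
  proof -
    have u: "u \<in> leaves" "v \<notin> leaves" using that by (auto simp: leaf_nbs_def inner_def)
    then have "{u, v} \<notin> inner_edges" "{u, v} \<notin> K2_edges"
      by (auto simp: inner_edges_def K2_edges_def inner_def)
    moreover have "(THE x. x \<in> {u, v} \<inter> leaves) = u"
      using u by (intro the_equality) auto
    ultimately show ?thesis by (simp add: we_def)
  qed
  have we_K2: "we e = idx e" if e: "e \<in> K2_edges" for e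
  proof -
    obtain u where "u \<in> e" using edge_nonempty[of e] e unfolding K2_edges_def by blast
    then have "e \<notin> inner_edges" using e by (auto simp: inner_edges_def K2_edges_def inner_def)
    then show ?thesis using e by (simp add: we_def)
  qed
  define b where "b v = (\<Sum>e\<in>{e \<in> E. v \<in> e}. we e)" for v
  have b_eq: "b v = s * degree inner_edges v + (\<Sum>p = off v..<off v + k v. slot s p)" if "v \<in> L" for v
  proof -
    have vi: "v \<in> inner" using that by (simp add: L_def)
    have "b v = (\<Sum>e\<in>{e \<in> inner_edges. v \<in> e}. we e) + (\<Sum>e\<in>(\<lambda>u. {u, v}) ` leaf_nbs v. we e)"
      unfolding b_def edges_at_inner[OF vi]
      using finite_inner_edges finite_leaf_nbs edges_at_inner_disjoint by (intro sum.union_disjoint) auto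
    also have "(\<Sum>e\<in>{e \<in> inner_edges. v \<in> e}. we e) = s * degree inner_edges v"
      by (simp add: we_def degree_def)
    also have "(\<Sum>e\<in>(\<lambda>u. {u, v}) ` leaf_nbs v. we e) = (\<Sum>u\<in>leaf_nbs v. slot s (pos u))"
      unfolding sum.reindex[OF inj_on_leaf_edge] using we_pendant[OF vi] by simp
    also have "\<dots> = (\<Sum>p = off v..<off v + k v. slot s p)"
      using pos_bij[OF that] by (rule sum.reindex_bij_betw)
    finally show ?thesis .
  qed
  \<comment> \<open>This puts the inner vertices above \<open>2 * s\<close>, out of reach of all
    leaves.\<close>
  have b_ge: "2 * s \<le> b v" if v: "v \<in> inner" for v
  proof (cases "v \<in> L")
    case True
    define a where "a = num_odd (off v) (k v)"
    have "a \<le> (k v + 1) div 2" by (auto simp: a_def num_odd_eq mod2_eq_if intro: div_le_mono)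
    moreover have "3 \<le> degree inner_edges v + k v"
      using degree_inner[OF v] by (simp add: k_def)
    \<comment> \<open>At most about half of the leaf edges are small, so after the shortfall of
      \<open>sum_slot_ge\<close> the worth of two edges of weight \<open>s\<close> remains.\<close>
    ultimately have "2 + (a + 1) div 2 \<le> degree inner_edges v + k v" by linarith
    then have "s * (2 + (a + 1) div 2) \<le> s * (degree inner_edges v + k v)"
      by (rule mult_le_mono2)
    moreover have "off v + k v \<le> 2 * s" using off True by (force simp: s_def)
    then have "s * k v \<le> (\<Sum>p = off v..<off v + k v. slot s p) + s * ((a + 1) div 2)"
      unfolding a_def by (rule sum_slot_ge)
    ultimately show ?thesis
      unfolding b_eq[OF True] by (simp add: algebra_simps)
  next
    case False
    then have "leaf_nbs v = {}" using in_L v by blast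
    then have eq: "{e \<in> E. v \<in> e} = {e \<in> inner_edges. v \<in> e}" using edges_at_inner[OF v] by simp
    have "b v = s * degree E v" unfolding b_def degree_def eq by (simp add: we_def)
    moreover have "s * 3 \<le> s * degree E v" using degree_inner[OF v] by simp
    ultimately show ?thesis by linarith
  qed
  define P where "P = {v \<in> L. odd (num_odd (off v) (k v))}"
  have P_sub: "P \<subseteq> inner" by (auto simp: P_def L_def)
  have n_lt: "n < 2 * s" by (simp add: s_def)
  \<comment> \<open>Inner edges contribute multiples of \<open>s\<close>, so \<open>b v\<close>
    modulo \<open>s\<close> is a small weight from the block of \<open>v\<close> and determines
    \<open>v\<close>.\<close>
  have "inj_on b P"
  proof (rule inj_onI)
    fix v w assume vw: "v \<in> P" "w \<in> P" "b v = b w"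
    have ex: "\<exists>p\<in>{off x..<off x + k x}. odd p \<and> b x mod s = slot s p" if "x \<in> P" for x
    proof -
      have "off x + k x < 2 * s" using off that n_lt by (fastforce simp: P_def)
      then show ?thesis
        using sum_slot_mod[of "off x" "k x" s] that by (simp add: P_def b_eq)
    qed
    obtain p where p: "p \<in> {off v..<off v + k v}" "odd p" "b v mod s = slot s p"
      using ex[OF vw(1)] by blast
    obtain q where q: "q \<in> {off w..<off w + k w}" "odd q" "b w mod s = slot s q"
      using ex[OF vw(2)] by blast
    have "p < n" "q < n" using p(1) q(1) off vw by (fastforce simp: P_def)+
    then have "p = q"
      using slot_eq_odd[of p n q s] p q vw(3) by (simp add: s_def)
    then show "v = w"
      using disj p(1) q(1) vw(1,2) by (fastforce simp: P_def)
  qed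
  \<comment> \<open>For nonempty \<open>inner\<close>, \<open>card inner < card ?B + card L\<close>,
    and by \<open>cnt\<close> twice the right-hand side is at most
    \<open>2 * card P + n + n mod 2\<close>. So fewer than \<open>n / 2\<close> rounded up vertices
    lie outside \<open>P\<close>.\<close>
  have Q: "card (inner - P) < s"
  proof (cases "inner = {}")
    case True
    then show ?thesis by (simp add: s_def)
  next
    case False
    let ?Z = "{v \<in> inner. k v = 0}" and ?B = "{v \<in> inner. 2 \<le> k v}"
    have "inner = ?Z \<union> L" by (auto simp: L_def)
    then have "card inner \<le> card ?Z + card L" by (metis card_Un_le)
    moreover have "card ?Z < card ?B"
      using card_no_leaf_nbs_less[OF False] by (simp add: k_def)
    moreover have "card (inner - P) + card P = card inner"
      using P_sub finite_inner by (metis card_Diff_subset card_mono finite_subset le_add_diff_inverse2)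
    moreover have "2 * card L + 2 * card ?B = (\<Sum>v\<in>L. if k v = 1 then 2 else 4)"
    proof -
      have B: "card ?B = (\<Sum>v\<in>L. if 2 \<le> k v then 1 else 0)"
      proof -
        have "?B = {v \<in> L. 2 \<le> k v}" by (auto simp: L_def)
        then show ?thesis using fL by (simp add: sum.If_cases Int_def)
      qed
      have "2 * card L + 2 * card ?B = (\<Sum>v\<in>L. 2 + 2 * (if 2 \<le> k v then 1 else 0))"
        unfolding B sum.distrib sum_distrib_left by simp
      also have "\<dots> = (\<Sum>v\<in>L. if k v = 1 then 2 else 4)"
        using L1 by (intro sum.cong) auto
      finally show ?thesis .
    qed
    moreover have "n mod 2 \<le> 1" "n = 2 * (n div 2) + n mod 2" by simp_all
    ultimately show ?thesis
      using cnt unfolding P_def[symmetric] s_def by linarith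
  qed
  obtain f where f_inj: "inj_on f inner" and f: "\<And>v. v \<in> inner \<Longrightarrow> b v < f v \<and> f v \<le> b v + s"
    using distinct_representatives[OF finite_inner \<open>inj_on b P\<close> P_sub Q] by blast
  define first where "first e = (SOME u. u \<in> e)" for e :: "'a set"
  \<comment> \<open>The \<open>i\<close>-th single-edge component gets the weighted degrees \<open>h + 1 + i\<close> and \<open>s + i\<close>, in the two
    gaps that the other leaves leave between light and heavy small weights, and above \<open>s\<close>.\<close>
  define wv where "wv u = (if u \<in> inner then f u - b u
    else if u \<in> \<Union> K2_edges then (if u \<in> first ` K2_edges then h + 1 else s)
    else leaf_weight c (pos u))" for u
  have wt_inner: "wt E wv we v = f v" if "v \<in> inner" for v
    using f[OF that] that by (simp add: wt_def wv_def b_def[symmetric])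
  have first_in: "first e \<in> e" if "e \<in> K2_edges" for e
  proof -
    have "e \<noteq> {}" using edge_nonempty that by (simp add: K2_edges_def)
    then show ?thesis unfolding first_def by (metis some_in_eq)
  qed
  have K2_eq: "e = e'" if "e \<in> K2_edges" "e' \<in> K2_edges" "u \<in> e" "u \<in> e'" for e e' u
    using that leaf_edge_unique[of u e e'] by (auto simp: K2_edges_def)
  have first_iff: "u \<in> first ` K2_edges \<longleftrightarrow> u = first e" if "e \<in> K2_edges" "u \<in> e" for u e
    using that first_in K2_eq by blast
  have wt_K2: "wt E wv we u = (if u = first e then h + 1 else s) + idx e"
    if "e \<in> K2_edges" "u \<in> e" for u e
  proof -
    have u: "u \<in> leaves" "e \<in> E" using that by (auto simp: K2_edges_def)
    then have "wv u = (if u = first e then h + 1 else s)"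
      using that first_iff[OF that] by (auto simp: wv_def inner_def)
    then show ?thesis
      using leaf_edges[OF u that(2)] we_K2[OF that(1)] by (simp add: wt_def)
  qed
  have wv_pendant: "wv u = leaf_weight c (pos u)" if "v \<in> inner" "u \<in> leaf_nbs v" for u v
    using that leaf_nbs_K2_disjoint[OF that(2,1)] by (auto simp: wv_def inner_def leaf_nbs_def)
  have wt_pendant: "wt E wv we u = slot s (pos u) + leaf_weight c (pos u)"
    if "v \<in> inner" "u \<in> leaf_nbs v" for u v
  proof -
    have "u \<in> leaves" "{u, v} \<in> E" using that by (auto simp: leaf_nbs_def)
    then have "{e \<in> E. u \<in> e} = {{u, v}}" by (intro leaf_edges) auto
    then show ?thesis
      using we_pendant[OF that] wv_pendant[OF that] by (simp add: wt_def)
  qed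
  have V_cases: "v \<in> inner \<or> v \<in> \<Union> K2_edges \<or> (\<exists>w\<in>inner. v \<in> leaf_nbs w)" if "v \<in> V" for v
    using that leaves_eq by (auto simp: inner_def)
  \<comment> \<open>So \<open>h + 1\<close> is an admissible weight, and the lower gap ends at or
    below \<open>s\<close>, before the upper one starts.\<close>
  have hs: "h + 1 + c \<le> s" by (auto simp: h_def s_def)
  have "wv v \<in> {1..s}" if "v \<in> V" for v
    using V_cases[OF that]
  proof (elim disjE bexE)
    assume "v \<in> inner"
    then show ?thesis using f[of v] by (auto simp: wv_def)
  next
    assume "v \<in> \<Union> K2_edges"
    then have "v \<notin> inner" by (auto simp: K2_edges_def inner_def)
    then show ?thesis using \<open>v \<in> \<Union> K2_edges\<close> hs by (auto simp: wv_def)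
  next
    fix w assume w: "w \<in> inner" "v \<in> leaf_nbs w"
    have "pos v div 2 \<le> n div 2" using pos_lt[OF w] by (intro div_le_mono) simp
    then show ?thesis using wv_pendant[OF w] by (auto simp: leaf_weight_def s_def)
  qed
  moreover have "we e \<in> {1..s}" if e: "e \<in> E" for e
  proof (cases "e \<in> inner_edges \<or> e \<in> K2_edges")
    case True
    then show ?thesis using idx_in[of e] hs by (auto simp: we_def s_def)
  next
    case False
    obtain x where x: "x \<in> e" "x \<in> inner"
      using False e edge[OF e] unfolding K2_edges_def inner_def by blast
    from e x(1) obtain u where u: "e = {u, x}" "u \<in> V" by (rule edge_at)
    then have "u \<in> leaf_nbs x" using False e x by (auto simp: inner_edges_def leaf_nbs_def inner_def)
    then show ?thesis
      using we_pendant[OF x(2)] u slot_bounds[OF pos_lt[OF x(2)], of u s] by (simp add: s_def)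
  qed
  moreover have "inj_on (wt E wv we) V"
  proof -
    \<comment> \<open>The three classes never meet: single-edge components stay inside the two gaps,
      other leaves avoid the gaps and stay up to \<open>2 * s\<close>, and inner vertices lie above
      \<open>2 * s\<close>.\<close>
    have K2_range: "wt E wv we u \<in> {h + 2..h + 1 + c} \<union> {s + 1..s + c}" if "u \<in> \<Union> K2_edges" for u
      using that wt_K2 idx_in by force
    have pendant_range: "wt E wv we u \<notin> {h + 2..h + 1 + c} \<union> {s + 1..s + c}" "wt E wv we u \<le> 2 * s"
      if "v \<in> inner" "u \<in> leaf_nbs v" for u v
      using slot_leaf_weight_even[OF s_def h_def pos_lt[OF that]] slot_leaf_weight_odd[OF s_def h_def pos_lt[OF that]] hs
      unfolding wt_pendant[OF that] by (cases "even (pos u)"; fastforce)+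
    have inner_range: "2 * s < wt E wv we v" if "v \<in> inner" for v
      using wt_inner[OF that] f[OF that] b_ge[OF that] by linarith
    have K2_le: "wt E wv we u \<le> 2 * s" if "u \<in> \<Union> K2_edges" for u
      using K2_range[OF that] hs by auto
    have K2_inj: "u = v" if uv: "u \<in> \<Union> K2_edges" "v \<in> \<Union> K2_edges" "wt E wv we u = wt E wv we v" for u v
    proof -
      obtain e e' where e: "e \<in> K2_edges" "u \<in> e" and e': "e' \<in> K2_edges" "v \<in> e'"
        using uv by blast
      \<comment> \<open>The gap tells which end of the edge it is, the place within the gap tells
        which edge.\<close>
      have "idx e = idx e' \<and> (u = first e \<longleftrightarrow> v = first e')"
        using uv(3) idx_in[OF e(1)] idx_in[OF e'(1)] hs
        unfolding wt_K2[OF e] wt_K2[OF e'] by (auto split: if_splits)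
      then have "e = e'" and iff: "u = first e \<longleftrightarrow> v = first e"
        using idx e(1) e'(1) by (auto simp: bij_betw_def inj_on_def)
      have "card e = 2" using edge e(1) by (simp add: K2_edges_def)
      then show ?thesis
        using e(2) e'(2) first_in[OF e(1)] \<open>e = e'\<close> iff by (auto simp: card_2_iff)
    qed
    show ?thesis
    proof (rule inj_onI)
      fix u v assume uv: "u \<in> V" "v \<in> V" and eq: "wt E wv we u = wt E wv we v"
      show "u = v"
        using V_cases[OF uv(1)]
      proof (elim disjE bexE)
        assume u: "u \<in> inner"
        have "v \<in> inner"
          using V_cases[OF uv(2)] inner_range[OF u] K2_le[of v] pendant_range(2)[of _ v] eq by force
        then show ?thesis using u eq wt_inner f_inj by (simp add: inj_on_def)
      next
        assume u: "u \<in> \<Union> K2_edges"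
        have "v \<in> \<Union> K2_edges"
          using V_cases[OF uv(2)] K2_le[OF u] K2_range[OF u] inner_range[of v] pendant_range(1)[of _ v] eq
          by (metis not_less)
        then show ?thesis using K2_inj u eq by blast
      next
        fix w assume w: "w \<in> inner" "u \<in> leaf_nbs w"
        obtain x where x: "x \<in> inner" "v \<in> leaf_nbs x"
          using V_cases[OF uv(2)] pendant_range[OF w] K2_range[of v] inner_range[of v] eq
          by (metis not_less)
        have "pos u = pos v"
          using inj_on_slot_leaf_weight[OF s_def h_def] eq pos_lt[OF w] pos_lt[OF x]
          unfolding wt_pendant[OF w] wt_pendant[OF x] by (auto simp: inj_on_def)
        then show ?thesis using pos_eq w x by blast
      qed
    qed
  qed
  ultimately show ?thesis
    unfolding irregular_total_weighting_def s_eq[symmetric] by blast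
qed

section \<open>Lower bound from the weighted degrees of the leaves\<close>

lemma irregular_total_weighting_ge:
  assumes "irregular_total_weighting V E s wv we" "V \<noteq> {}"
  shows "card leaves div 2 + 1 \<le> s"
proof -
  have wv: "\<And>v. v \<in> V \<Longrightarrow> wv v \<in> {1..s}" and we: "\<And>e. e \<in> E \<Longrightarrow> we e \<in> {1..s}"
    and inj: "inj_on (wt E wv we) V"
    using assms(1) by (auto simp: irregular_total_weighting_def)
  \<comment> \<open>A leaf collects just two weights, so only \<open>2 * s - 1\<close> values are
    available.\<close>
  have "wt E wv we u \<in> {2..2 * s}" if u: "u \<in> leaves" for u
  proof -
    obtain e where e: "e \<in> E" "u \<in> e" using ex_leaf_edge[OF u] by blast
    have "wt E wv we u = wv u + we e" using leaf_edges[OF u e] by (simp add: wt_def)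
    then show ?thesis using wv[of u] we[OF e(1)] u by (auto simp: leaves_def)
  qed
  then have "wt E wv we ` leaves \<subseteq> {2..2 * s}" by blast
  moreover have "inj_on (wt E wv we) leaves"
    using inj by (rule inj_on_subset) (auto simp: leaves_def)
  ultimately have "card leaves \<le> card {2..2 * s}"
    by (metis card_inj_on_le finite_atLeastAtMost)
  \<comment> \<open>A vertex excludes \<open>s = 0\<close>, where the truncated
    \<open>2 * s - 1\<close> would be 0.\<close>
  moreover obtain v where "v \<in> V" using assms(2) by blast
  then have "1 \<le> s" using wv by force
  ultimately show ?thesis by simp
qed

end

lemma nat_ceiling_half: "nat \<lceil>(real n + 1) / 2\<rceil> = n div 2 + 1"
proof -
  have "\<lceil>(real n + 1) / 2\<rceil> = int (n div 2 + 1)"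
    by (cases "even n") (auto elim!: evenE oddE intro!: ceiling_unique)
  then show ?thesis by simp
qed

theorem theorem1:
  fixes V :: "'a set" and E :: "'a set set"
  assumes "forest V E" and "V \<noteq> {}"
    and "\<forall>v\<in>V. degree E v \<noteq> 2"
    and "\<forall>v\<in>V. degree E v \<noteq> 0"
  shows "tvs V E = nat (ceiling ((real (card {v\<in>V. degree E v = 1}) + 1) / 2))"
proof -
  interpret forest_without_degree_2 V E
    using assms by unfold_locales auto
  have "tvs V E = card leaves div 2 + 1"
    unfolding tvs_def
    using ex_irregular_total_weighting irregular_total_weighting_ge[OF _ assms(2)]
    by (intro Least_equality) blast+
  then show ?thesis
    by (simp only: nat_ceiling_half leaves_def)
qed

end
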